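(* Let $n\ge3$. The classes $Q_{11}$ and $S_{11}$ of holomorphic function germs $(\mathbb{C}^n,0)\to(\mathbb{C},0)$ are not in the same bi-Lipschitz class: no germ in $Q_{11}$ is bi-Lipschitz equivalent to a germ in $S_{11}$.
   Context: $Q_{11}$ is the class of germs equivalent, by a biholomorphic change of coordinates of $(\mathbb{C}^n,0)$, to $x^3+y^2z+xz^3+a z^5+w_1^2+\cdots+w_{n-3}^2$ for some $a\in\mathbb{C}$. $S_{11}$ is the class of germs equivalent, by a biholomorphic change of coordinates, to $x^4+y^2z+xz^2+a x^3z+w_1^2+\cdots+w_{n-3}^2$ for some $a\in\mathbb{C}$. Here $(x,y,z,w_1,\dots,w_{n-3})$ are coordinates on $\mathbb{C}^n$. Two germs $f,g:(\mathbb{C}^n,0)\to(\mathbb{C},0)$ are bi-Lipschitz equivalent if there is a homeomorphism germ $\varphi:(\mathbb{C}^n,0)\to(\mathbb{C}^n,0)$ with $f\circ\varphi=g$ and $\frac1L\|x-y\|\le\|\varphi(x)-\varphi(y)\|\le L\|x-y\|$ near $0$ for some $L>0$. *)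

theory Defs
  imports "HOL-Analysis.Analysis"
begin

text \<open>
  Points of $\mathbb{C}^n$ are vectors of type \<^typ>\<open>complex^'n\<close>; the library norm on this type is the
  Hermitian norm. A germ at \<open>0\<close> is given by a representative, a total function whose values away
  from \<open>0\<close> are irrelevant: every notion below depends only on its values near \<open>0\<close>.
\<close>

definition holo_on :: "(complex^'n \<Rightarrow> complex) \<Rightarrow> (complex^'n) set \<Rightarrow> bool" where
  "holo_on f U \<longleftrightarrow>
     (\<forall>v\<in>U. \<exists>D. (f has_derivative D) (at v) \<and> (\<forall>c h. D (c *s h) = c * D h))"

definition holo_map_on :: "(complex^'n \<Rightarrow> complex^'m) \<Rightarrow> (complex^'n) set \<Rightarrow> bool" where
  "holo_map_on F U \<longleftrightarrow> (\<forall>l. holo_on (\<lambda>v. F v $ l) U)"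

definition holo_germ :: "(complex^'n \<Rightarrow> complex) \<Rightarrow> bool" where
  "holo_germ f \<longleftrightarrow> f 0 = 0 \<and> (\<exists>U. open U \<and> 0 \<in> U \<and> holo_on f U)"

definition biholo_germ :: "(complex^'n \<Rightarrow> complex^'n) \<Rightarrow> bool" where
  "biholo_germ \<Phi> \<longleftrightarrow>
     \<Phi> 0 = 0 \<and>
     (\<exists>U V \<Psi>. open U \<and> 0 \<in> U \<and> open V \<and> 0 \<in> V \<and> homeomorphism U V \<Phi> \<Psi> \<and>
        holo_map_on \<Phi> U \<and> holo_map_on \<Psi> V)"

definition biholo_equiv ::
    "(complex^'n \<Rightarrow> complex) \<Rightarrow> (complex^'n \<Rightarrow> complex) \<Rightarrow> bool" where
  "biholo_equiv f g \<longleftrightarrow> (\<exists>\<Phi>. biholo_germ \<Phi> \<and> (\<forall>\<^sub>F v in nhds 0. f (\<Phi> v) = g v))"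

definition homeo_germ :: "(complex^'n \<Rightarrow> complex^'n) \<Rightarrow> bool" where
  "homeo_germ \<phi> \<longleftrightarrow>
     \<phi> 0 = 0 \<and>
     (\<exists>U V \<psi>. open U \<and> 0 \<in> U \<and> open V \<and> 0 \<in> V \<and> homeomorphism U V \<phi> \<psi>)"

definition bilipschitz_near_0 :: "(complex^'n \<Rightarrow> complex^'n) \<Rightarrow> bool" where
  "bilipschitz_near_0 \<phi> \<longleftrightarrow>
     (\<exists>L>0. \<exists>W. open W \<and> 0 \<in> W \<and>
        (\<forall>x\<in>W. \<forall>y\<in>W. 1 / L * norm (x - y) \<le> norm (\<phi> x - \<phi> y) \<and>
                       norm (\<phi> x - \<phi> y) \<le> L * norm (x - y)))"

definition bilipschitz_equiv ::
    "(complex^'n \<Rightarrow> complex) \<Rightarrow> (complex^'n \<Rightarrow> complex) \<Rightarrow> bool" where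
  "bilipschitz_equiv f g \<longleftrightarrow>
     (\<exists>\<phi>. homeo_germ \<phi> \<and> (\<forall>\<^sub>F v in nhds 0. f (\<phi> v) = g v) \<and> bilipschitz_near_0 \<phi>)"

text \<open>
  In the normal forms, \<open>i\<close>, \<open>j\<close>, \<open>k\<close> are the indices of the coordinates $x$, $y$, $z$, and the
  remaining $n - 3$ coordinates are the $w_l$. Relabelling coordinates is biholomorphic, so the
  classes defined from any one labelling and from all labellings agree.
\<close>

definition Q11_form :: "'n \<Rightarrow> 'n \<Rightarrow> 'n \<Rightarrow> complex \<Rightarrow> complex^'n \<Rightarrow> complex" where
  "Q11_form i j k a v =
     (v$i)^3 + (v$j)^2 * v$k + v$i * (v$k)^3 + a * (v$k)^5 + (\<Sum>l\<in>UNIV - {i, j, k}. (v$l)^2)"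

definition S11_form :: "'n \<Rightarrow> 'n \<Rightarrow> 'n \<Rightarrow> complex \<Rightarrow> complex^'n \<Rightarrow> complex" where
  "S11_form i j k a v =
     (v$i)^4 + (v$j)^2 * v$k + v$i * (v$k)^2 + a * (v$i)^3 * v$k + (\<Sum>l\<in>UNIV - {i, j, k}. (v$l)^2)"

definition Q11 :: "(complex^'n \<Rightarrow> complex) set" where
  "Q11 = {f. holo_germ f \<and> (\<exists>i j k a. distinct [i, j, k] \<and> biholo_equiv f (Q11_form i j k a))}"

definition S11 :: "(complex^'n \<Rightarrow> complex) set" where
  "S11 = {f. holo_germ f \<and> (\<exists>i j k a. distinct [i, j, k] \<and> biholo_equiv f (S11_form i j k a))}"

end

theory Submission
  imports Defs "HOL-Complex_Analysis.Cauchy_Integral_Formula"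
begin

text \<open>
  Biholomorphic germs are bi-Lipschitz, so an equivalence would give a bi-Lipschitz germ $\theta$ with
  $f \circ \theta = g$ for the two normal forms. Let $\Theta$ be a limit of the rescalings
  $\theta(\varepsilon x)/\varepsilon$. Since $\theta$ is bi-Lipschitz, $|\nabla f(\theta(v))|$ is bounded by
  a multiple of $|\nabla g(v)|$. On the subspace $w = 0$ the latter is $O(|v|^2)$, hence the
  $w$-components of $\theta(v)$ are $O(|v|^2)$ and their squares do not contribute to order three.
  Therefore $\Theta$ maps the subspace $w = 0$ of one germ onto that of the other and conjugates the
  cubics $x^3 + y^2z$ and $y^2z + xz^2$. It also matches their critical sets, which are lines. This is
  impossible: off its singular line the zero set of the first cubic is connected, while that of the
  second, $z(y^2 + xz) = 0$, splits into two disjoint closed pieces.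
\<close>

section \<open>Lipschitz germs\<close>

definition lip_germ :: "('a::real_normed_vector \<Rightarrow> 'b::real_normed_vector) \<Rightarrow> bool" where
  "lip_germ \<theta> \<longleftrightarrow> \<theta> 0 = 0 \<and> (\<exists>L r. r > 0 \<and> L-lipschitz_on (ball 0 r) \<theta>)"

text \<open>The inverse is kept as explicit data: total functions representing germs invert each
  other only near 0, and the later arguments are run in both directions.\<close>

definition lip_inverse_germs :: "('a::real_normed_vector \<Rightarrow> 'b::real_normed_vector) \<Rightarrow> ('b \<Rightarrow> 'a) \<Rightarrow> bool" where
  "lip_inverse_germs \<theta> \<psi> \<longleftrightarrow> lip_germ \<theta> \<and> lip_germ \<psi> \<and>
     (\<forall>\<^sub>F x in nhds 0. \<psi> (\<theta> x) = x) \<and> (\<forall>\<^sub>F y in nhds 0. \<theta> (\<psi> y) = y)"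

lemma lip_inverse_germs_sym: "lip_inverse_germs \<theta> \<psi> \<Longrightarrow> lip_inverse_germs \<psi> \<theta>"
  by (auto simp: lip_inverse_germs_def)

lemma lip_germ_filterlim:
  assumes "lip_germ \<theta>" shows "filterlim \<theta> (nhds 0) (nhds 0)"
proof -
  from assms obtain L r where r: "r > 0" "L-lipschitz_on (ball 0 r) \<theta>" and 0: "\<theta> 0 = 0"
    by (auto simp: lip_germ_def)
  have "continuous_on (ball 0 r) \<theta>"
    by (rule lipschitz_on_continuous_on[OF r(2)])
  then have "isCont \<theta> 0"
    using r(1) by (simp add: continuous_on_eq_continuous_at)
  then have "filterlim \<theta> (nhds (\<theta> 0)) (nhds 0)"
    by (simp only: isCont_def tendsto_at_iff_tendsto_nhds)
  then show ?thesis using 0 by simp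
qed

lemma lip_germ_compose:
  assumes "lip_germ \<theta>" "lip_germ \<psi>" shows "lip_germ (\<theta> \<circ> \<psi>)"
proof -
  from assms(1) obtain L r where r: "r > 0" "L-lipschitz_on (ball 0 r) \<theta>"
    by (auto simp: lip_germ_def)
  from assms(2) obtain M s where s: "s > 0" "M-lipschitz_on (ball 0 s) \<psi>"
    by (auto simp: lip_germ_def)
  have "\<forall>\<^sub>F x in nhds 0. \<psi> x \<in> ball 0 r"
    using lip_germ_filterlim[OF assms(2)] r(1) by (intro topological_tendstoD) auto
  then obtain d where d: "d > 0" "\<And>x. dist x 0 < d \<Longrightarrow> \<psi> x \<in> ball 0 r"
    by (auto simp: eventually_nhds_metric)
  have "(L * M)-lipschitz_on (ball 0 (min s d)) (\<theta> \<circ> \<psi>)"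
  proof (rule lipschitz_on_compose)
    show "M-lipschitz_on (ball 0 (min s d)) \<psi>"
      by (rule lipschitz_on_subset[OF s(2)]) auto
    show "L-lipschitz_on (\<psi> ` ball 0 (min s d)) \<theta>"
      by (rule lipschitz_on_subset[OF r(2)]) (use d in \<open>auto simp: dist_commute\<close>)
  qed
  moreover have "min s d > 0" using s d by simp
  ultimately show ?thesis
    using assms unfolding lip_germ_def by (metis comp_apply)
qed

lemma lip_inverse_germs_compose:
  assumes "lip_inverse_germs \<theta> \<theta>'" "lip_inverse_germs \<psi> \<psi>'"
  shows "lip_inverse_germs (\<theta> \<circ> \<psi>) (\<psi>' \<circ> \<theta>')"
proof -
  have "\<forall>\<^sub>F x in nhds 0. \<theta>' (\<theta> (\<psi> x)) = \<psi> x"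
    using assms lip_germ_filterlim[of \<psi>] by (auto simp: lip_inverse_germs_def filterlim_iff)
  moreover have "\<forall>\<^sub>F x in nhds 0. \<psi> (\<psi>' (\<theta>' x)) = \<theta>' x"
    using assms lip_germ_filterlim[of \<theta>'] by (auto simp: lip_inverse_germs_def filterlim_iff)
  moreover have "\<forall>\<^sub>F x in nhds 0. \<psi>' (\<psi> x) = x" "\<forall>\<^sub>F x in nhds 0. \<theta> (\<theta>' x) = x"
    using assms by (auto simp: lip_inverse_germs_def)
  ultimately show ?thesis
    using assms unfolding lip_inverse_germs_def
    by (auto simp: lip_germ_compose elim: eventually_elim2)
qed

text \<open>The lower bound for \<phi>, read at the points \<psi> x and \<psi> y, is the Lipschitz
  bound for \<psi>. Continuity of \<psi> at 0 brings these points into the set \<open>W\<close> on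
  which the bound is available.\<close>

lemma homeo_germ_bilipschitz_inverse:
  fixes \<phi> :: "complex^'n \<Rightarrow> complex^'n"
  assumes "homeo_germ \<phi>" "bilipschitz_near_0 \<phi>"
  shows "\<exists>\<psi>. lip_inverse_germs \<phi> \<psi>"
proof -
  from assms(1) obtain U V \<psi> where U: "open U" "0 \<in> U" and V: "open V" "0 \<in> V"
    and hom: "homeomorphism U V \<phi> \<psi>" and "\<phi> 0 = 0"
    by (auto simp: homeo_germ_def)
  from assms(2) obtain L W where L: "L > 0" and W: "open W" "0 \<in> W"
    and bl: "\<And>x y. x \<in> W \<Longrightarrow> y \<in> W \<Longrightarrow> 1 / L * norm (x - y) \<le> norm (\<phi> x - \<phi> y) \<and>
                       norm (\<phi> x - \<phi> y) \<le> L * norm (x - y)"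
    unfolding bilipschitz_near_0_def by metis
  have inv: "\<And>x. x \<in> U \<Longrightarrow> \<psi> (\<phi> x) = x" "\<And>y. y \<in> V \<Longrightarrow> \<phi> (\<psi> y) = y"
    using hom by (auto simp: homeomorphism_def)
  have \<psi>0: "\<psi> 0 = 0" using inv(1)[OF U(2)] \<open>\<phi> 0 = 0\<close> by simp
  have "isCont \<psi> 0"
    using hom V by (auto simp: homeomorphism_def continuous_on_eq_continuous_at)
  then have "filterlim \<psi> (nhds (\<psi> 0)) (nhds 0)"
    by (simp only: isCont_def tendsto_at_iff_tendsto_nhds)
  then have lim: "filterlim \<psi> (nhds 0) (nhds 0)"
    using \<psi>0 by simp
  have "\<forall>\<^sub>F y in nhds 0. \<psi> y \<in> W \<and> y \<in> V"
    by (intro eventually_conj topological_tendstoD[OF lim] eventually_nhds_in_open W V)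
  then obtain s where s: "s > 0" "\<And>y. dist y 0 < s \<Longrightarrow> \<psi> y \<in> W \<and> y \<in> V"
    by (auto simp: eventually_nhds_metric)
  obtain r where r: "r > 0" "ball 0 r \<subseteq> W"
    using W open_contains_ball by blast
  have "L-lipschitz_on (ball 0 r) \<phi>"
    by (rule lipschitz_onI) (use r bl L in \<open>auto simp: dist_norm subset_iff\<close>)
  then have "lip_germ \<phi>"
    using r(1) \<open>\<phi> 0 = 0\<close> by (auto simp: lip_germ_def)
  moreover have "L-lipschitz_on (ball 0 s) \<psi>"
  proof (rule lipschitz_onI)
    fix x y :: "complex^'n" assume "x \<in> ball 0 s" "y \<in> ball 0 s"
    then have "\<psi> x \<in> W" "\<psi> y \<in> W" "x \<in> V" "y \<in> V" using s by (auto simp: dist_commute)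
    then have "1 / L * norm (\<psi> x - \<psi> y) \<le> norm (x - y)"
      using bl[of "\<psi> x" "\<psi> y"] inv by auto
    then show "dist (\<psi> x) (\<psi> y) \<le> L * dist x y"
      using L by (simp add: dist_norm field_simps)
  qed (use L in auto)
  then have "lip_germ \<psi>"
    using s(1) \<psi>0 by (auto simp: lip_germ_def)
  moreover have "\<forall>\<^sub>F x in nhds 0. \<psi> (\<phi> x) = x" "\<forall>\<^sub>F y in nhds 0. \<phi> (\<psi> y) = y"
    using inv U V by (auto simp: eventually_nhds)
  ultimately show ?thesis by (auto simp: lip_inverse_germs_def)
qed

section \<open>Cauchy estimates: biholomorphic germs are Lipschitz\<close>

lemma holo_on_derivative_bound:
  fixes f :: "complex^'n \<Rightarrow> complex"
  assumes holo: "holo_on f U" and sub: "cball v r \<subseteq> U" and r: "r > 0"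
    and B: "\<And>u. u \<in> cball v r \<Longrightarrow> norm (f u) \<le> B"
    and D: "(f has_derivative D) (at v)" "\<And>c h. D (c *s h) = c * D h"
  shows "norm (D h) \<le> B / r * norm h"
proof -
  have unit: "norm (D e) \<le> B / r" if e: "norm e = 1" for e
  proof -
    \<comment> \<open>On the complex line through \<open>v\<close> in the unit direction
      \<open>e\<close> the claim becomes the one-variable Cauchy inequality. Complex homogeneity of
      \<open>D\<close> identifies \<open>D e\<close> with the derivative of the restriction at
      0.\<close>
    define g where "g c = f (v + c *s e)" for c :: complex
    have norm_s: "norm (c *s e) = norm c" for c :: complex
      using e by (simp add: norm_vec_def norm_mult L2_set_right_distrib[symmetric])
    have lin: "((\<lambda>c. v + c *s e) has_derivative (\<lambda>c. c *s e)) (at c)" for c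
    proof -
      have "bounded_linear (\<lambda>c::complex. c *s e)"
        by (rule bounded_linear_intro[where K = 1])
          (auto simp: norm_s vec_eq_iff algebra_simps)
      from bounded_linear.has_derivative[OF this has_derivative_ident] show ?thesis
        by (auto intro!: derivative_eq_intros)
    qed
    have der: "\<exists>d. (g has_field_derivative d) (at c)" if "c \<in> cball 0 r" for c
    proof -
      have "v + c *s e \<in> U"
        using that sub norm_s[of c] by (auto simp: dist_norm subset_iff)
      then obtain D' where D': "(f has_derivative D') (at (v + c *s e))" "\<And>c h. D' (c *s h) = c * D' h"
        using holo by (auto simp: holo_on_def)
      have "(g has_derivative (\<lambda>x. D' (x *s e))) (at c)"
        unfolding g_def by (rule has_derivative_compose[OF lin D'(1)])
      then have "(g has_field_derivative D' e) (at c)"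
        by (simp add: has_field_derivative_def D'(2) mult_commute_abs)
      then show ?thesis by blast
    qed
    have "(g has_derivative (\<lambda>x. D (x *s e))) (at 0)"
      unfolding g_def by (rule has_derivative_compose[OF lin]) (simp add: D(1))
    then have "(g has_field_derivative D e) (at 0)"
      by (simp add: has_field_derivative_def D(2) mult_commute_abs)
    then have "deriv g 0 = D e" by (rule DERIV_imp_deriv)
    moreover have "norm ((deriv ^^ 1) g 0) \<le> fact 1 * B / r ^ 1"
    proof (rule Cauchy_inequality)
      show "g holomorphic_on ball 0 r"
        unfolding holomorphic_on_def field_differentiable_def
        using der by (meson ball_subset_cball has_field_derivative_at_within subset_iff)
      show "continuous_on (cball 0 r) g"
        using der by (meson DERIV_isCont continuous_at_imp_continuous_on)
      show "norm (g x) \<le> B" if "norm (0 - x) = r" for x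
        unfolding g_def using that norm_s[of x] by (intro B) (simp add: dist_norm)
    qed (use r in auto)
    ultimately show ?thesis by simp
  qed
  have lin: "bounded_linear D" using D(1) by (rule has_derivative_bounded_linear)
  show ?thesis
  proof (cases "h = 0")
    case False
    then have "norm (D (h /\<^sub>R norm h)) \<le> B / r" by (intro unit) simp
    then show ?thesis using False by (simp add: linear_cmul[OF bounded_linear.linear[OF lin]] field_simps)
  qed (simp add: linear_0[OF bounded_linear.linear[OF lin]])
qed

lemma holo_on_imp_lipschitz:
  fixes f :: "complex^'n \<Rightarrow> complex"
  assumes holo: "holo_on f U" and U: "open U" "0 \<in> U"
  shows "\<exists>L r. r > 0 \<and> L-lipschitz_on (ball 0 r) f"
proof -
  obtain R where R: "R > 0" "cball 0 R \<subseteq> U"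
    using U open_contains_cball by blast
  have "continuous_on (cball 0 R) f"
    using holo R(2) unfolding holo_on_def
    by (meson continuous_at_imp_continuous_on has_derivative_continuous subset_iff)
  then have "bounded (f ` cball 0 R)"
    by (intro compact_imp_bounded compact_continuous_image) auto
  then obtain B where B: "B > 0" "\<And>u. u \<in> cball 0 R \<Longrightarrow> norm (f u) \<le> B"
    by (auto simp: bounded_pos)
  \<comment> \<open>Halving the radius keeps every ball of radius \<open>r\<close> about a point of
    \<open>ball 0 r\<close> inside \<open>cball 0 R\<close>, so one constant \<open>B\<close> serves
    in the Cauchy estimate at all these points.\<close>
  define r where "r = R / 2"
  have r: "r > 0" using R by (simp add: r_def)
  have sub: "cball v r \<subseteq> cball 0 R" if "v \<in> ball 0 r" for v :: "complex^'n"
    using that by (auto simp: r_def cball_subset_cball_iff)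
  from holo obtain D where D: "\<And>v. v \<in> U \<Longrightarrow> (f has_derivative D v) (at v)"
      "\<And>v c h. v \<in> U \<Longrightarrow> D v (c *s h) = c * D v h"
    unfolding holo_on_def by metis
  have inU: "v \<in> U" if "v \<in> ball 0 r" for v
    using that R by (auto simp: r_def)
  have "(B / r)-lipschitz_on (ball 0 r) f"
  proof (rule lipschitz_onI)
    fix x y :: "complex^'n" assume xy: "x \<in> ball 0 r" "y \<in> ball 0 r"
    have "norm (f x - f y) \<le> B / r * norm (x - y)"
    proof (rule differentiable_bound[OF convex_ball])
      fix v :: "complex^'n" assume v: "v \<in> ball 0 r"
      show "(f has_derivative D v) (at v within ball 0 r)"
        using D(1)[OF inU[OF v]] by (rule has_derivative_at_withinI)
      show "onorm (D v) \<le> B / r"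
      proof (rule onorm_bound)
        show "norm (D v h) \<le> B / r * norm h" for h
          using sub[OF v] R(2) B r D inU[OF v]
          by (intro holo_on_derivative_bound[OF holo]) auto
      qed (use B r in auto)
    qed (use xy in auto)
    then show "dist (f x) (f y) \<le> B / r * dist x y" by (simp add: dist_norm)
  qed (use B r in auto)
  with r show ?thesis by blast
qed

lemma holo_map_lip_germ:
  fixes F :: "complex^'n \<Rightarrow> complex^'m"
  assumes holo: "holo_map_on F U" and U: "open U" "0 \<in> U" and "F 0 = 0"
  shows "lip_germ F"
proof -
  have "\<exists>L r. r > 0 \<and> L-lipschitz_on (ball 0 r) (\<lambda>v. F v $ l)" for l
    using holo U by (intro holo_on_imp_lipschitz) (auto simp: holo_map_on_def)
  then obtain L r where L: "\<And>l. r l > 0" "\<And>l. (L l)-lipschitz_on (ball 0 (r l)) (\<lambda>v. F v $ l)"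
    by metis
  define s where "s = Min (range r)"
  have s: "s > 0" "\<And>l. s \<le> r l"
    using L(1) by (auto simp: s_def)
  have "(\<Sum>l\<in>UNIV. L l)-lipschitz_on (ball 0 s) F"
  proof (rule lipschitz_onI)
    fix x y :: "complex^'n" assume xy: "x \<in> ball 0 s" "y \<in> ball 0 s"
    have "norm (F x - F y) \<le> (\<Sum>l\<in>UNIV. norm ((F x - F y) $ l))"
      unfolding norm_vec_def by (rule L2_set_le_sum) simp
    also have "\<dots> \<le> (\<Sum>l\<in>UNIV. L l * norm (x - y))"
    proof (rule sum_mono)
      fix l
      have "x \<in> ball 0 (r l)" "y \<in> ball 0 (r l)" using xy s(2)[of l] by auto
      from lipschitz_onD[OF L(2) this] show "norm ((F x - F y) $ l) \<le> L l * norm (x - y)"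
        by (simp add: dist_norm)
    qed
    finally show "dist (F x) (F y) \<le> (\<Sum>l\<in>UNIV. L l) * dist x y"
      by (simp add: dist_norm sum_distrib_right)
  next
    show "0 \<le> (\<Sum>l\<in>UNIV. L l)"
      by (intro sum_nonneg lipschitz_on_nonneg[OF L(2)])
  qed
  with s(1) \<open>F 0 = 0\<close> show ?thesis by (auto simp: lip_germ_def)
qed

lemma biholo_germ_inverse:
  assumes "biholo_germ \<Phi>"
  shows "\<exists>\<Psi>. lip_inverse_germs \<Phi> \<Psi>"
proof -
  from assms obtain U V \<Psi> where U: "open U" "0 \<in> U" and V: "open V" "0 \<in> V"
    and hom: "homeomorphism U V \<Phi> \<Psi>" and "\<Phi> 0 = 0"
    and holo: "holo_map_on \<Phi> U" "holo_map_on \<Psi> V"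
    by (auto simp: biholo_germ_def)
  have inv: "\<And>x. x \<in> U \<Longrightarrow> \<Psi> (\<Phi> x) = x" "\<And>y. y \<in> V \<Longrightarrow> \<Phi> (\<Psi> y) = y"
    using hom by (auto simp: homeomorphism_def)
  have "\<Psi> 0 = 0" using inv(1)[OF U(2)] \<open>\<Phi> 0 = 0\<close> by simp
  then have "lip_germ \<Phi>" "lip_germ \<Psi>"
    using holo U V \<open>\<Phi> 0 = 0\<close> by (auto intro: holo_map_lip_germ)
  moreover have "\<forall>\<^sub>F x in nhds 0. \<Psi> (\<Phi> x) = x" "\<forall>\<^sub>F y in nhds 0. \<Phi> (\<Psi> y) = y"
    using inv U V by (auto simp: eventually_nhds)
  ultimately show ?thesis by (auto simp: lip_inverse_germs_def)
qed

section \<open>Passage from the germs to their normal forms\<close>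

lemma equiv_normal_forms:
  assumes "bilipschitz_equiv f g" "biholo_equiv f p" "biholo_equiv g q"
  shows "\<exists>\<theta> \<psi>. lip_inverse_germs \<theta> \<psi> \<and> (\<forall>\<^sub>F v in nhds 0. p (\<theta> v) = q v)"
proof -
  obtain \<phi> where \<phi>: "homeo_germ \<phi>" "bilipschitz_near_0 \<phi>" and fg: "\<forall>\<^sub>F v in nhds 0. f (\<phi> v) = g v"
    using assms(1) by (auto simp: bilipschitz_equiv_def)
  obtain \<alpha> where \<alpha>: "biholo_germ \<alpha>" and fp: "\<forall>\<^sub>F v in nhds 0. f (\<alpha> v) = p v"
    using assms(2) by (auto simp: biholo_equiv_def)
  obtain \<beta> where \<beta>: "biholo_germ \<beta>" and gq: "\<forall>\<^sub>F v in nhds 0. g (\<beta> v) = q v"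
    using assms(3) by (auto simp: biholo_equiv_def)
  obtain \<phi>' where \<phi>': "lip_inverse_germs \<phi> \<phi>'"
    using homeo_germ_bilipschitz_inverse[OF \<phi>] by blast
  obtain \<alpha>' where \<alpha>': "lip_inverse_germs \<alpha> \<alpha>'"
    using biholo_germ_inverse[OF \<alpha>] by blast
  obtain \<beta>' where \<beta>': "lip_inverse_germs \<beta> \<beta>'"
    using biholo_germ_inverse[OF \<beta>] by blast
  \<comment> \<open>Near 0, p = f o \<alpha> and q = g o \<beta>. The composite of \<beta>, \<phi>
    and \<alpha>' therefore conjugates the normal forms: it carries p to f o \<phi> o \<beta> = g o
    \<beta> = q.\<close>
  have inv: "lip_inverse_germs (\<alpha>' \<circ> (\<phi> \<circ> \<beta>)) ((\<beta>' \<circ> \<phi>') \<circ> \<alpha>)"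
    by (intro lip_inverse_germs_compose lip_inverse_germs_sym[OF \<alpha>'] \<phi>' \<beta>')
  have lim: "filterlim \<beta> (nhds 0) (nhds 0)" "filterlim (\<alpha>' \<circ> (\<phi> \<circ> \<beta>)) (nhds 0) (nhds 0)"
      "filterlim (\<phi> \<circ> \<beta>) (nhds 0) (nhds 0)"
    using \<beta>' \<phi>' inv by (auto simp: lip_inverse_germs_def intro!: lip_germ_filterlim lip_germ_compose)
  have \<alpha>\<alpha>: "\<forall>\<^sub>F y in nhds 0. \<alpha> (\<alpha>' y) = y"
    using \<alpha>' by (simp add: lip_inverse_germs_def)
  have "\<forall>\<^sub>F v in nhds 0. p ((\<alpha>' \<circ> (\<phi> \<circ> \<beta>)) v) = q v"
    using eventually_compose_filterlim[OF fp lim(2)] eventually_compose_filterlim[OF fg lim(1)]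
      eventually_compose_filterlim[OF \<alpha>\<alpha> lim(3)] gq
    by eventually_elim simp
  with inv show ?thesis by blast
qed

section \<open>Comparison of derivatives\<close>

text \<open>No chain rule is available, as \<theta> is only Lipschitz. Instead the increments of
  \<open>g\<close> at \<open>p\<close> are those of \<open>f\<close> along \<theta>; up to a
  first-order error they are at most \<open>K\<close> times the displacement of \<theta>, which is
  at most \<open>L\<close> times that of the argument.\<close>

lemma has_derivative_norm_le_conjugated:
  fixes f :: "'b::real_normed_vector \<Rightarrow> 'c::real_normed_vector" and \<theta> :: "'a::real_normed_vector \<Rightarrow> 'b"
  assumes f: "(f has_derivative D) (at (\<theta> p))" and g: "(g has_derivative D') (at p)"
    and eq: "\<forall>\<^sub>F x in nhds p. f (\<theta> x) = g x"
    and lip: "L-lipschitz_on S \<theta>" "open S" "p \<in> S"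
    and D: "\<And>h. norm (D h) \<le> K * norm h" and K: "K \<ge> 0"
  shows "norm (D' h) \<le> K * L * norm h"
proof -
  have L: "L \<ge> 0" using lip(1) by (rule lipschitz_on_nonneg)
  interpret D': bounded_linear D' using g by (rule has_derivative_bounded_linear)
  have bound: "norm (D' h) \<le> ((K + e) * L + e) * norm h" if e: "e > 0" for e
  proof -
    have "\<forall>\<^sub>F y in nhds (\<theta> p). norm (f y - f (\<theta> p) - D (y - \<theta> p)) \<le> e * norm (y - \<theta> p)"
      using f e unfolding has_derivative_at_alt by (fastforce simp: eventually_nhds_metric dist_norm)
    moreover have "filterlim \<theta> (nhds (\<theta> p)) (nhds p)"
      using continuous_on_interior[OF lipschitz_on_continuous_on[OF lip(1)]] lip(2,3)
      by (metis interior_open isCont_def tendsto_at_iff_tendsto_nhds)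
    ultimately have "\<forall>\<^sub>F x in nhds p. norm (f (\<theta> x) - f (\<theta> p) - D (\<theta> x - \<theta> p)) \<le> e * norm (\<theta> x - \<theta> p)"
      by (auto simp: filterlim_iff)
    moreover have "\<forall>\<^sub>F x in nhds p. norm (g x - g p - D' (x - p)) \<le> e * norm (x - p)"
      using g e unfolding has_derivative_at_alt by (fastforce simp: eventually_nhds_metric dist_norm)
    moreover have "\<forall>\<^sub>F x in nhds p. x \<in> S"
      using lip by (simp add: eventually_nhds_in_open)
    ultimately have near: "\<forall>\<^sub>F x in nhds p. norm (D' (x - p)) \<le> ((K + e) * L + e) * norm (x - p)"
      using eq
    proof eventually_elim
      case (elim x)
      have fg: "f (\<theta> x) - f (\<theta> p) = g x - g p"
        using elim eventually_nhds_x_imp_x[OF eq] by simp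
      have "norm (g x - g p) \<le> norm (D (\<theta> x - \<theta> p)) + e * norm (\<theta> x - \<theta> p)"
        using elim(1) norm_triangle_ineq2[of "g x - g p" "D (\<theta> x - \<theta> p)"] unfolding fg by linarith
      also have "\<dots> \<le> (K + e) * norm (\<theta> x - \<theta> p)"
        using D[of "\<theta> x - \<theta> p"] by (simp add: algebra_simps)
      also have "\<dots> \<le> (K + e) * (L * norm (x - p))"
        using lipschitz_onD[OF lip(1) elim(3) lip(3)] K e by (intro mult_left_mono) (auto simp: dist_norm)
      finally have 1: "norm (g x - g p) \<le> (K + e) * (L * norm (x - p))" .
      have "norm (D' (x - p)) \<le> norm (g x - g p) + e * norm (x - p)"
        using elim(2) norm_triangle_ineq3[of "D' (x - p)" "g x - g p"]
        by (simp add: norm_minus_commute)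
      with 1 show ?case by (simp add: algebra_simps)
    qed
    \<comment> \<open>Approaching \<open>p\<close> along the ray in direction \<open>h\<close> lets
      linearity of \<open>D'\<close> cancel the factor \<open>t\<close>, so the estimate for small
      increments becomes one for every \<open>h\<close>.\<close>
    have "filterlim (\<lambda>t. p + t *\<^sub>R h) (nhds (p + 0 *\<^sub>R h)) (at_right 0)"
      by (intro tendsto_intros)
    then have "\<forall>\<^sub>F t in at_right 0. norm (D' (t *\<^sub>R h)) \<le> ((K + e) * L + e) * norm (t *\<^sub>R h)"
      using near by (auto simp: filterlim_iff)
    then have "\<forall>\<^sub>F t in at_right (0::real). t > 0 \<and> norm (D' (t *\<^sub>R h)) \<le> ((K + e) * L + e) * norm (t *\<^sub>R h)"
      using eventually_at_right_less by (rule eventually_elim2) auto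
    then obtain t :: real where "t > 0" "norm (D' (t *\<^sub>R h)) \<le> ((K + e) * L + e) * norm (t *\<^sub>R h)"
      using eventually_happens trivial_limit_at_right_real by blast
    then show ?thesis by (simp add: D'.scaleR)
  qed
  have "((\<lambda>e. ((K + e) * L + e) * norm h) \<longlongrightarrow> ((K + 0) * L + 0) * norm h) (at_right 0)"
    by (intro tendsto_intros)
  moreover have "\<forall>\<^sub>F e in at_right 0. norm (D' h) \<le> ((K + e) * L + e) * norm h"
    using eventually_at_right_less by eventually_elim (rule bound)
  ultimately show ?thesis
    using tendsto_lowerbound trivial_limit_at_right_real by fastforce
qed

section \<open>Tangent maps\<close>

text \<open>Tychonoff's theorem; a filter on the parameter replaces the subsequence, as the product is not
  first countable.\<close>

lemma pointwise_limit_of_compact_values: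
  fixes T :: "'e \<Rightarrow> 'x \<Rightarrow> 'a::topological_space"
  assumes G: "G \<noteq> bot" and K: "\<And>x. compact (K x)"
    and ev: "\<And>x. \<forall>\<^sub>F e in G. T e x \<in> K x"
  shows "\<exists>F \<Theta>. F \<noteq> bot \<and> F \<le> G \<and> (\<forall>x. ((\<lambda>e. T e x) \<longlongrightarrow> \<Theta> x) F)"
proof -
  \<comment> \<open>\<open>T' e\<close> lies in the product of the sets \<open>K x\<close> for every
    \<open>e\<close>, whereas \<open>T e x\<close> lies in \<open>K x\<close> only from a stage on
    that may depend on \<open>x\<close>. For each fixed \<open>x\<close> the two agree
    eventually.\<close>
  define T' where "T' e x = (if T e x \<in> K x then T e x else (SOME y. y \<in> K x))" for e x
  have ne: "\<exists>y. y \<in> K x" for x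
    using eventually_happens'[OF G ev] by blast
  have in_K: "T' e \<in> PiE UNIV K" for e
    using someI_ex[OF ne] by (auto simp: T'_def PiE_def Pi_def)
  have "compactin (product_topology (\<lambda>_. euclidean) UNIV) (PiE UNIV K)"
    using K by (simp add: compactin_PiE)
  then have "compact (PiE UNIV K)"
    by (simp add: euclidean_product_topology)
  moreover have "filtermap T' G \<noteq> bot"
    using G by (simp add: filtermap_bot_iff)
  ultimately obtain \<Theta> where \<Theta>: "inf (nhds \<Theta>) (filtermap T' G) \<noteq> bot"
    unfolding compact_filter using in_K
    by (metis (mono_tags, lifting) always_eventually eventually_filtermap)
  \<comment> \<open>Compactness yields only a cluster point \<Theta>. Refining \<open>G\<close> by
    the pullback of its neighbourhoods gives a filter along which \<open>T'\<close> converges to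
    \<Theta>; that this filter is proper is the cluster property.\<close>
  define F where "F = inf G (filtercomap T' (nhds \<Theta>))"
  have "F \<noteq> bot"
  proof
    assume "F = bot"
    then obtain P Q where PQ: "eventually P G" "eventually Q (nhds \<Theta>)" "\<And>e. \<not> (P e \<and> Q (T' e))"
      unfolding F_def trivial_limit_def eventually_inf eventually_filtercomap by blast
    have "eventually (\<lambda>y. \<not> Q y) (filtermap T' G)"
      unfolding eventually_filtermap using PQ(1) by eventually_elim (use PQ(3) in blast)
    with PQ(2) have "inf (nhds \<Theta>) (filtermap T' G) = bot"
      unfolding trivial_limit_def eventually_inf by blast
    with \<Theta> show False ..
  qed
  moreover have "F \<le> G" by (simp add: F_def)
  moreover have "((\<lambda>e. T e x) \<longlongrightarrow> \<Theta> x) F" for x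
  proof -
    have "filterlim T' (nhds \<Theta>) F"
      unfolding F_def by (rule filterlim_mono[OF filterlim_filtercomap order_refl inf_le2])
    from continuous_on_tendsto_compose[OF continuous_on_product_coordinates[of x] this]
    have "((\<lambda>e. T' e x) \<longlongrightarrow> \<Theta> x) F" by simp
    moreover have "\<forall>\<^sub>F e in F. T' e x = T e x"
      using filter_leD[OF \<open>F \<le> G\<close> ev[of x]] by eventually_elim (simp add: T'_def)
    ultimately show ?thesis by (rule Lim_transform_eventually)
  qed
  ultimately show ?thesis by blast
qed

section \<open>Rescaled germs and their limits\<close>

lemma eventually_scaled_nhds:
  fixes x :: "'a::real_normed_vector"
  assumes "eventually P (nhds 0)"
  shows "\<forall>\<^sub>F e in at_right 0. P (e *\<^sub>R x)"
proof -
  have "((\<lambda>e. e *\<^sub>R x) \<longlongrightarrow> 0 *\<^sub>R x) (at_right 0)" by (intro tendsto_intros)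
  with assms show ?thesis by (auto simp: filterlim_iff)
qed

lemma rescaled_lipschitz:
  fixes \<theta> :: "'a::real_normed_vector \<Rightarrow> 'b::real_normed_vector"
  assumes "L-lipschitz_on (ball 0 r) \<theta>" "e > 0" "e *\<^sub>R x \<in> ball 0 r" "e *\<^sub>R y \<in> ball 0 r"
  shows "norm (\<theta> (e *\<^sub>R x) /\<^sub>R e - \<theta> (e *\<^sub>R y) /\<^sub>R e) \<le> L * norm (x - y)"
proof -
  have "norm (\<theta> (e *\<^sub>R x) /\<^sub>R e - \<theta> (e *\<^sub>R y) /\<^sub>R e) = norm (\<theta> (e *\<^sub>R x) - \<theta> (e *\<^sub>R y)) / e"
    using \<open>e > 0\<close> unfolding scaleR_diff_right[symmetric] norm_scaleR by (simp add: divide_inverse_commute)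
  also have "\<dots> \<le> L * norm (e *\<^sub>R x - e *\<^sub>R y) / e"
    using lipschitz_onD[OF assms(1,3,4)] \<open>e > 0\<close> by (simp add: dist_norm divide_right_mono)
  also have "\<dots> = L * norm (x - y)"
    using \<open>e > 0\<close> unfolding scaleR_diff_right[symmetric] norm_scaleR by simp
  finally show ?thesis .
qed

text \<open>The point \<open>u e\<close> may move with \<open>e\<close>: besides constants, this is
  applied to the rescaled values of a germ, for which \<open>e *\<^sub>R u e\<close> is the value of
  the germ itself.\<close>

lemma eventually_scaled_in_ball:
  fixes u :: "real \<Rightarrow> 'a::real_normed_vector"
  assumes F: "F \<le> at_right 0" and u: "(u \<longlongrightarrow> y) F" and r: "r > 0"
  shows "\<forall>\<^sub>F e in F. e *\<^sub>R u e \<in> ball 0 r"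
proof -
  have "((\<lambda>e. e) \<longlongrightarrow> 0) F"
    by (rule tendsto_mono[OF F]) (rule tendsto_ident_at)
  from tendsto_scaleR[OF this u] have "((\<lambda>e. e *\<^sub>R u e) \<longlongrightarrow> 0) F" by simp
  from topological_tendstoD[OF this open_ball, of 0 r] r show ?thesis by simp
qed

lemma tangent_map_lipschitz:
  fixes \<theta> :: "'a::real_normed_vector \<Rightarrow> 'b::real_normed_vector"
  assumes L: "L-lipschitz_on (ball 0 r) \<theta>" "r > 0"
    and F: "F \<noteq> bot" "F \<le> at_right 0"
    and lim: "\<And>x. ((\<lambda>e. \<theta> (e *\<^sub>R x) /\<^sub>R e) \<longlongrightarrow> \<Theta> x) F"
  shows "L-lipschitz_on UNIV \<Theta>"
proof (rule lipschitz_onI)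
  fix x y
  have "\<forall>\<^sub>F e in F. norm (\<theta> (e *\<^sub>R x) /\<^sub>R e - \<theta> (e *\<^sub>R y) /\<^sub>R e) \<le> L * norm (x - y)"
    using eventually_scaled_in_ball[OF F(2) tendsto_const[of x] L(2)]
      eventually_scaled_in_ball[OF F(2) tendsto_const[of y] L(2)]
      filter_leD[OF F(2) eventually_at_right_less]
  proof eventually_elim
    case (elim e)
    then show ?case by (intro rescaled_lipschitz[OF L(1)])
  qed
  then have "norm (\<Theta> x - \<Theta> y) \<le> L * norm (x - y)"
    by (rule tendsto_upperbound[OF tendsto_norm[OF tendsto_diff[OF lim lim]] _ F(1)])
  then show "dist (\<Theta> x) (\<Theta> y) \<le> L * dist x y" by (simp add: dist_norm)
next
  show "0 \<le> L" using L(1) by (rule lipschitz_on_nonneg)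
qed

text \<open>Since \<psi> undoes \<theta>, the rescaled \<psi> sends the rescaled value of \<theta>
  at \<open>x\<close> exactly to \<open>x\<close>. Its Lipschitz constant is uniform in
  \<open>e\<close>, so this moving argument may be replaced by its limit \<open>y\<close>.\<close>

lemma tangent_map_left_inverse:
  fixes \<theta> :: "'a::real_normed_vector \<Rightarrow> 'b::real_normed_vector"
  assumes M: "M-lipschitz_on (ball 0 r) \<psi>" "r > 0"
    and inv: "\<forall>\<^sub>F x in nhds 0. \<psi> (\<theta> x) = x"
    and F: "F \<noteq> bot" "F \<le> at_right 0"
    and lim: "((\<lambda>e. \<theta> (e *\<^sub>R x) /\<^sub>R e) \<longlongrightarrow> y) F" "((\<lambda>e. \<psi> (e *\<^sub>R y) /\<^sub>R e) \<longlongrightarrow> z) F"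
  shows "z = x"
proof -
  have pos: "\<forall>\<^sub>F e in F. e > 0"
    using filter_leD[OF F(2) eventually_at_right_less] .
  have "\<forall>\<^sub>F e in F. norm (x - \<psi> (e *\<^sub>R y) /\<^sub>R e) \<le> M * norm (\<theta> (e *\<^sub>R x) /\<^sub>R e - y)"
    using eventually_scaled_in_ball[OF F(2) lim(1) M(2)]
      eventually_scaled_in_ball[OF F(2) tendsto_const[of y] M(2)]
      filter_leD[OF F(2) eventually_scaled_nhds[OF inv, of x]] pos
  proof eventually_elim
    case (elim e)
    from rescaled_lipschitz[OF M(1) elim(4,1,2)] elim(3,4) show ?case by simp
  qed
  then have "\<forall>\<^sub>F e in F. norm (\<psi> (e *\<^sub>R y) /\<^sub>R e - x) \<le> M * norm (\<theta> (e *\<^sub>R x) /\<^sub>R e - y)"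
    by (simp add: norm_minus_commute)
  moreover have "((\<lambda>e. M * norm (\<theta> (e *\<^sub>R x) /\<^sub>R e - y)) \<longlongrightarrow> M * norm (y - y)) F"
    by (intro tendsto_mult tendsto_norm tendsto_diff tendsto_const lim(1))
  then have "((\<lambda>e. M * norm (\<theta> (e *\<^sub>R x) /\<^sub>R e - y)) \<longlongrightarrow> 0) F"
    by simp
  ultimately have "((\<lambda>e. \<psi> (e *\<^sub>R y) /\<^sub>R e - x) \<longlongrightarrow> 0) F"
    by (rule Lim_null_comparison)
  then have "((\<lambda>e. \<psi> (e *\<^sub>R y) /\<^sub>R e) \<longlongrightarrow> x) F"
    by (simp add: LIM_zero_iff)
  then show ?thesis by (rule tendsto_unique[OF F(1) lim(2)])
qed

lemma tangent_maps_exist: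
  fixes \<theta> \<psi> :: "'a::euclidean_space \<Rightarrow> 'a"
  assumes inv: "lip_inverse_germs \<theta> \<psi>"
  shows "\<exists>F \<Theta> \<Psi> L. F \<noteq> bot \<and> F \<le> at_right 0 \<and>
    (\<forall>x. ((\<lambda>e. \<theta> (e *\<^sub>R x) /\<^sub>R e) \<longlongrightarrow> \<Theta> x) F) \<and> (\<forall>y. ((\<lambda>e. \<psi> (e *\<^sub>R y) /\<^sub>R e) \<longlongrightarrow> \<Psi> y) F) \<and>
    (\<forall>x. \<Psi> (\<Theta> x) = x) \<and> (\<forall>y. \<Theta> (\<Psi> y) = y) \<and>
    L-lipschitz_on UNIV \<Theta> \<and> L-lipschitz_on UNIV \<Psi>"
proof -
  obtain L r where L: "L-lipschitz_on (ball 0 r) \<theta>" "r > 0" and \<theta>0: "\<theta> 0 = 0"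
    using inv by (auto simp: lip_inverse_germs_def lip_germ_def)
  obtain M s where M: "M-lipschitz_on (ball 0 s) \<psi>" "s > 0" and \<psi>0: "\<psi> 0 = 0"
    using inv by (auto simp: lip_inverse_germs_def lip_germ_def)
  \<comment> \<open>Taking the limit of the pair gives one filter for both germs; limits taken along
    unrelated filters need not be inverse to each other.\<close>
  define T where "T e x = (\<theta> (e *\<^sub>R x) /\<^sub>R e, \<psi> (e *\<^sub>R x) /\<^sub>R e)" for e :: real and x :: 'a
  have "\<forall>\<^sub>F e in at_right 0. T e x \<in> cball 0 (L * norm x) \<times> cball 0 (M * norm x)" for x
    using eventually_scaled_in_ball[OF order_refl tendsto_const[of x] L(2)]
      eventually_scaled_in_ball[OF order_refl tendsto_const[of x] M(2)] eventually_at_right_less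
  proof eventually_elim
    case (elim e)
    show ?case
      using rescaled_lipschitz[OF L(1) elim(3,1), of 0] rescaled_lipschitz[OF M(1) elim(3,2), of 0]
        L(2) M(2) by (simp add: T_def \<theta>0 \<psi>0)
  qed
  then have "\<exists>F H. F \<noteq> bot \<and> F \<le> at_right 0 \<and> (\<forall>x. ((\<lambda>e. T e x) \<longlongrightarrow> H x) F)"
    by (intro pointwise_limit_of_compact_values[where K = "\<lambda>x. cball 0 (L * norm x) \<times> cball 0 (M * norm x)"]
        trivial_limit_at_right_real compact_Times compact_cball)
  then obtain F H where F: "F \<noteq> bot" "F \<le> at_right 0" and H: "\<And>x. ((\<lambda>e. T e x) \<longlongrightarrow> H x) F"
    by blast
  have \<Theta>: "((\<lambda>e. \<theta> (e *\<^sub>R x) /\<^sub>R e) \<longlongrightarrow> fst (H x)) F"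
    and \<Psi>: "((\<lambda>e. \<psi> (e *\<^sub>R x) /\<^sub>R e) \<longlongrightarrow> snd (H x)) F" for x
    using tendsto_fst[OF H[of x]] tendsto_snd[OF H[of x]] by (auto simp: T_def)
  have ev: "\<forall>\<^sub>F x in nhds 0. \<psi> (\<theta> x) = x" "\<forall>\<^sub>F x in nhds 0. \<theta> (\<psi> x) = x"
    using inv by (auto simp: lip_inverse_germs_def)
  show ?thesis
  proof (intro exI conjI allI)
    show "F \<noteq> bot" "F \<le> at_right 0" by (fact F)+
    show "((\<lambda>e. \<theta> (e *\<^sub>R x) /\<^sub>R e) \<longlongrightarrow> fst (H x)) F" for x by (fact \<Theta>)
    show "((\<lambda>e. \<psi> (e *\<^sub>R y) /\<^sub>R e) \<longlongrightarrow> snd (H y)) F" for y by (fact \<Psi>)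
    show "snd (H (fst (H x))) = x" for x
      by (rule tangent_map_left_inverse[OF M ev(1) F \<Theta> \<Psi>])
    show "fst (H (snd (H y))) = y" for y
      by (rule tangent_map_left_inverse[OF L ev(2) F \<Psi> \<Theta>])
    show "(max L M)-lipschitz_on UNIV (\<lambda>x. fst (H x))"
      by (rule lipschitz_on_le[OF tangent_map_lipschitz[OF L F \<Theta>]]) simp
    show "(max L M)-lipschitz_on UNIV (\<lambda>x. snd (H x))"
      by (rule lipschitz_on_le[OF tangent_map_lipschitz[OF M F \<Psi>]]) simp
  qed
qed

section \<open>Germs with a cubic residual part\<close>

text \<open>Here \<open>p v\<close> is the gradient of \<open>f\<close> at \<open>v\<close>, and \<open>r\<close> collects the terms of order at least four in
  the variables of \<open>A\<close>, rescaled.\<close>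

locale cubic_germ =
  fixes A :: "'n::finite set" and c f :: "complex^'n \<Rightarrow> complex"
    and p :: "complex^'n \<Rightarrow> 'n \<Rightarrow> complex" and r :: "real \<Rightarrow> complex^'n \<Rightarrow> complex"
  assumes derivative: "(f has_derivative (\<lambda>h. \<Sum>l\<in>UNIV. p v l * h $ l)) (at v)"
    and gradient_outside: "l \<notin> A \<Longrightarrow> p v l = 2 * v $ l"
    and gradient_quadratic: "(\<And>l. l \<notin> A \<Longrightarrow> x $ l = 0) \<Longrightarrow>
      \<exists>q. continuous_on UNIV q \<and> (\<forall>t::real. p (t *\<^sub>R x) l = of_real (t^2) * q t)"
    and expansion: "f (t *\<^sub>R v) = of_real (t^3) * (c v + of_real t * r t v) + of_real (t^2) * (\<Sum>l\<in>-A. (v $ l)^2)"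
    and continuous_cubic: "continuous_on UNIV c"
    and continuous_remainder: "continuous_on UNIV (\<lambda>(t, v). r t v)"

text \<open>The factor left after removing \<open>t^2\<close> is continuous in \<open>t\<close>,
  hence bounded on [0,1]. The constant may depend on \<open>x\<close>, which suffices because the
  tangent map is a pointwise limit.\<close>

lemma (in cubic_germ) gradient_growth:
  assumes x: "\<And>l. l \<notin> A \<Longrightarrow> x $ l = 0"
  shows "\<exists>C. \<forall>t. 0 < t \<longrightarrow> t \<le> 1 \<longrightarrow> (\<Sum>l\<in>UNIV. norm (p (t *\<^sub>R x) l)) \<le> C * t^2"
proof -
  have "\<forall>l. \<exists>q. continuous_on UNIV q \<and> (\<forall>t::real. p (t *\<^sub>R x) l = of_real (t^2) * q t)"
    using gradient_quadratic[of x] x by blast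
  then obtain q where q: "\<And>l. continuous_on UNIV (q l)"
    "\<And>l t. p (t *\<^sub>R x) l = of_real (t^2) * q l t" for t :: real
    by metis
  have "continuous_on {0..1} (\<lambda>t. \<Sum>l\<in>UNIV. norm (q l t))"
    by (intro continuous_intros continuous_on_subset[OF q(1)] subset_UNIV)
  then have "bounded ((\<lambda>t. \<Sum>l\<in>UNIV. norm (q l t)) ` {0..1})"
    by (intro compact_imp_bounded compact_continuous_image compact_Icc)
  then obtain C where C: "\<And>t. t \<in> {0..1} \<Longrightarrow> norm (\<Sum>l\<in>UNIV. norm (q l t)) \<le> C"
    unfolding bounded_iff by blast
  have "(\<Sum>l\<in>UNIV. norm (p (t *\<^sub>R x) l)) \<le> C * t^2" if t: "0 < t" "t \<le> 1" for t
  proof -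
    have "(\<Sum>l\<in>UNIV. norm (p (t *\<^sub>R x) l)) = (\<Sum>l\<in>UNIV. norm (q l t)) * t^2"
      by (simp add: q(2) norm_mult norm_power sum_distrib_left mult.commute)
    also have "\<dots> \<le> C * t^2"
      using C[of t] t by (intro mult_right_mono) auto
    finally show ?thesis .
  qed
  then show ?thesis by blast
qed

lemma gradient_apply_bound:
  fixes h :: "complex^'n"
  shows "norm (\<Sum>l\<in>UNIV. p l * h $ l) \<le> (\<Sum>l\<in>UNIV. norm (p l)) * norm h"
proof -
  have "norm (\<Sum>l\<in>UNIV. p l * h $ l) \<le> (\<Sum>l\<in>UNIV. norm (p l) * norm h)"
    by (intro sum_norm_le) (auto simp: norm_mult intro!: mult_left_mono Finite_Cartesian_Product.norm_nth_le)
  then show ?thesis by (simp add: sum_distrib_right)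
qed

text \<open>For \<open>l\<close> outside \<open>A\<close> the partial derivative of \<open>f\<close>
  is twice the coordinate itself, so a bound on the derivative of \<open>f\<close> at \<theta> v
  bounds that coordinate. As f = g o \<psi> near \<theta> v, this derivative is controlled by that
  of \<open>g\<close> at \<open>v\<close>, which is quadratic along the ray of
  \<open>x\<close>.\<close>

lemma outer_component_quadratic:
  assumes f: "cubic_germ A c f p r" and g: "cubic_germ B d g q s"
    and inv: "lip_inverse_germs \<theta> \<psi>" and gf: "\<forall>\<^sub>F v in nhds 0. g (\<psi> v) = f v"
    and x: "\<And>l. l \<notin> B \<Longrightarrow> x $ l = 0" and l: "l \<notin> A"
  shows "\<exists>M. \<forall>\<^sub>F t in at_right 0. norm (\<theta> (t *\<^sub>R x) $ l) \<le> M * t^2"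
proof -
  obtain L \<rho> where L: "L-lipschitz_on (ball 0 \<rho>) \<psi>" "\<rho> > 0"
    using inv by (auto simp: lip_inverse_germs_def lip_germ_def)
  obtain C where C: "\<And>t. 0 < t \<Longrightarrow> t \<le> 1 \<Longrightarrow> (\<Sum>l\<in>UNIV. norm (q (t *\<^sub>R x) l)) \<le> C * t^2"
    using cubic_germ.gradient_growth[OF g, of x] x by metis
  have lim: "filterlim \<theta> (nhds 0) (nhds 0)"
    using inv by (auto simp: lip_inverse_germs_def intro: lip_germ_filterlim)
  \<comment> \<open>Comparing derivatives at \<theta> v needs the identity on a whole neighbourhood
    of that point, not only at the point.\<close>
  have "\<forall>\<^sub>F v in nhds 0. \<forall>\<^sub>F y in nhds (\<theta> v). g (\<psi> y) = f y"
    by (rule eventually_compose_filterlim[OF _ lim]) (simp add: eventually_eventually gf)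
  moreover have "\<forall>\<^sub>F v in nhds 0. \<theta> v \<in> ball 0 \<rho>"
    using L(2) by (intro topological_tendstoD[OF lim]) auto
  moreover have "\<forall>\<^sub>F v in nhds 0. \<psi> (\<theta> v) = v"
    using inv by (simp add: lip_inverse_germs_def)
  ultimately have "\<forall>\<^sub>F v in nhds 0. norm (2 * \<theta> v $ l) \<le> (\<Sum>l\<in>UNIV. norm (q v l)) * L"
  proof eventually_elim
    case (elim v)
    have "norm (\<Sum>m\<in>UNIV. p (\<theta> v) m * axis l 1 $ m) \<le> (\<Sum>l\<in>UNIV. norm (q v l)) * L * norm (axis l (1::complex))"
    proof (rule has_derivative_norm_le_conjugated[OF _ _ elim(1) L(1) open_ball elim(2)])
      show "(g has_derivative (\<lambda>h. \<Sum>l\<in>UNIV. q v l * h $ l)) (at (\<psi> (\<theta> v)))"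
        unfolding elim(3) by (rule cubic_germ.derivative[OF g])
      show "(f has_derivative (\<lambda>h. \<Sum>m\<in>UNIV. p (\<theta> v) m * h $ m)) (at (\<theta> v))"
        by (rule cubic_germ.derivative[OF f])
      show "norm (\<Sum>l\<in>UNIV. q v l * h $ l) \<le> (\<Sum>l\<in>UNIV. norm (q v l)) * norm h" for h
        by (rule gradient_apply_bound)
    qed (simp add: sum_nonneg)
    moreover have "(\<Sum>m\<in>UNIV. p (\<theta> v) m * axis l 1 $ m) = 2 * \<theta> v $ l"
      by (simp add: axis_def if_distrib cubic_germ.gradient_outside[OF f l] cong: if_cong)
    ultimately show ?case by simp
  qed
  from eventually_scaled_nhds[OF this, of x]
  have "\<forall>\<^sub>F t in at_right 0. norm (2 * \<theta> (t *\<^sub>R x) $ l) \<le> (\<Sum>l\<in>UNIV. norm (q (t *\<^sub>R x) l)) * L" .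
  moreover have "\<forall>\<^sub>F t in at_right 0. 0 < t \<and> t \<le> (1::real)"
    by (rule eventually_at_rightI[of 0 1]) auto
  ultimately have "\<forall>\<^sub>F t in at_right 0. norm (\<theta> (t *\<^sub>R x) $ l) \<le> (C * L / 2) * t^2"
  proof eventually_elim
    case (elim t)
    have "(\<Sum>l\<in>UNIV. norm (q (t *\<^sub>R x) l)) * L \<le> C * t^2 * L"
      using elim(2) C lipschitz_on_nonneg[OF L(1)] by (intro mult_right_mono) auto
    with elim(1) show ?case by (simp add: norm_mult mult_ac)
  qed
  then show ?thesis by blast
qed

text \<open>The identity for \<open>f\<close> and \<open>g\<close> along the ray of \<open>x\<close>
  is divided by \<open>e^3\<close> before passing to the limit. The squares outside \<open>A\<close>
  have only order two and could survive the division; they vanish in the limit because the outer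
  components of the rescaled map are O(e).\<close>

lemma tangent_map_cubic:
  assumes f: "cubic_germ A c f p r" and g: "cubic_germ B d g q s"
    and inv: "lip_inverse_germs \<theta> \<psi>" and fg: "\<forall>\<^sub>F v in nhds 0. f (\<theta> v) = g v"
    and gf: "\<forall>\<^sub>F v in nhds 0. g (\<psi> v) = f v"
    and F: "F \<noteq> bot" "F \<le> at_right 0"
    and lim: "((\<lambda>e. \<theta> (e *\<^sub>R x) /\<^sub>R e) \<longlongrightarrow> y) F"
    and x: "\<And>l. l \<notin> B \<Longrightarrow> x $ l = 0"
  shows "\<And>l. l \<notin> A \<Longrightarrow> y $ l = 0" and "c y = d x"
proof -
  define u where "u e = \<theta> (e *\<^sub>R x) /\<^sub>R e" for e
  have u: "(u \<longlongrightarrow> y) F" unfolding u_def by (rule lim)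
  have pos: "\<forall>\<^sub>F e in F. e > 0"
    using filter_leD[OF F(2) eventually_at_right_less] .
  have id: "((\<lambda>e. e) \<longlongrightarrow> 0) F"
    by (rule tendsto_mono[OF F(2)]) (rule tendsto_ident_at)
  have outer: "\<exists>M. \<forall>\<^sub>F e in F. norm (u e $ l) \<le> M * e" if l: "l \<notin> A" for l
  proof -
    obtain M where "\<forall>\<^sub>F t in at_right 0. norm (\<theta> (t *\<^sub>R x) $ l) \<le> M * t^2"
      using outer_component_quadratic[OF f g inv gf x l] by blast
    from filter_leD[OF F(2) this] pos have "\<forall>\<^sub>F e in F. norm (u e $ l) \<le> M * e"
      by eventually_elim (simp add: u_def field_simps power2_eq_square)
    then show ?thesis by blast
  qed
  show y: "y $ l = 0" if l: "l \<notin> A" for l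
  proof -
    obtain M where "\<forall>\<^sub>F e in F. norm (u e $ l) \<le> M * e" using outer[OF l] by blast
    moreover have "((\<lambda>e. M * e) \<longlongrightarrow> 0) F" using tendsto_mult_left[OF id, of M] by simp
    ultimately have "((\<lambda>e. u e $ l) \<longlongrightarrow> 0) F" by (rule Lim_null_comparison)
    moreover have "((\<lambda>e. u e $ l) \<longlongrightarrow> y $ l) F" by (intro tendsto_intros u)
    ultimately show ?thesis using F(1) tendsto_unique by blast
  qed
  have squares: "((\<lambda>e. (u e $ l)^2 / of_real e) \<longlongrightarrow> 0) F" if l: "l \<in> -A" for l
  proof -
    obtain M where "\<forall>\<^sub>F e in F. norm (u e $ l) \<le> M * e" using outer l by blast
    then have "\<forall>\<^sub>F e in F. norm ((u e $ l)^2 / of_real e) \<le> M^2 * e"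
      using pos
    proof eventually_elim
      case (elim e)
      have "norm (u e $ l) ^ 2 \<le> (M * e)^2" by (rule power_mono[OF elim(1)]) simp
      then show ?case using elim(2) by (simp add: norm_divide norm_mult field_simps power2_eq_square)
    qed
    moreover have "((\<lambda>e. M^2 * e) \<longlongrightarrow> 0) F" using tendsto_mult_left[OF id, of "M^2"] by simp
    ultimately show ?thesis by (rule Lim_null_comparison)
  qed
  have "\<forall>\<^sub>F e in F. d x + of_real e * s e x = c (u e) + of_real e * r e (u e) + (\<Sum>l\<in>-A. (u e $ l)^2 / of_real e)"
    using filter_leD[OF F(2) eventually_scaled_nhds[OF fg, of x]] pos
  proof eventually_elim
    case (elim e)
    have "(\<Sum>l\<in>-B. (x $ l)^2) = 0" by (rule sum.neutral) (simp add: x)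
    then have "of_real (e^3) * (d x + of_real e * s e x) = g (e *\<^sub>R x)"
      by (simp add: cubic_germ.expansion[OF g])
    also have "\<dots> = f (e *\<^sub>R u e)" using elim by (simp add: u_def)
    also have "\<dots> = of_real (e^3) * (c (u e) + of_real e * r e (u e) + (\<Sum>l\<in>-A. (u e $ l)^2 / of_real e))"
      using elim(2) unfolding cubic_germ.expansion[OF f] sum_divide_distrib[symmetric]
      by (simp add: field_simps power_numeral_reduce)
    finally show ?case using elim(2) by simp
  qed
  note expansions_eq = this
  \<comment> \<open>Parameter and point vary together, so joint continuity of the remainder is what
    makes it converge; the factor \<open>e\<close> in front then removes it.\<close>
  have rem: "((\<lambda>e. r' e (w e)) \<longlongrightarrow> r' 0 z) F"
    if "continuous_on UNIV (\<lambda>(t, v). r' t v)" "(w \<longlongrightarrow> z) F" for r' :: "real \<Rightarrow> complex^'n \<Rightarrow> complex" and w z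
  proof -
    have "isCont (\<lambda>(t, v). r' t v) (0, z)"
      using that(1) by (simp add: continuous_on_eq_continuous_at)
    from isCont_tendsto_compose[OF this tendsto_Pair[OF id that(2)]] show ?thesis by simp
  qed
  have cu: "((\<lambda>e. c (u e)) \<longlongrightarrow> c y) F"
    using continuous_on_tendsto_compose[OF cubic_germ.continuous_cubic[OF f] u] by simp
  have "((\<lambda>e. c (u e) + of_real e * r e (u e) + (\<Sum>l\<in>-A. (u e $ l)^2 / of_real e)) \<longlongrightarrow>
      c y + of_real 0 * r 0 y + (\<Sum>l\<in>-A. 0)) F"
    by (intro tendsto_add tendsto_mult tendsto_sum tendsto_of_real cu id squares
        rem[OF cubic_germ.continuous_remainder[OF f] u])
  moreover have "((\<lambda>e. d x + of_real e * s e x) \<longlongrightarrow> d x + of_real 0 * s 0 x) F"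
    by (intro tendsto_add tendsto_mult tendsto_of_real tendsto_const id
        rem[OF cubic_germ.continuous_remainder[OF g] tendsto_const])
  ultimately have "c y + of_real 0 * r 0 y + (\<Sum>l\<in>-A. 0) = d x + of_real 0 * s 0 x"
    using F(1) Lim_transform_eventually[OF _ expansions_eq] tendsto_unique by blast
  then show "c y = d x" by simp
qed

text \<open>The preceding lemma is applied to \<theta> and to \<psi> along the same filter. Hence
  \<Theta> and \<Psi> restrict to mutually inverse maps between the two coordinate subspaces; off
  these subspaces nothing is claimed about the cubics.\<close>

lemma cubic_germs_tangent_homeomorphism:
  fixes \<theta> \<psi> :: "complex^'n \<Rightarrow> complex^'n"
  assumes f: "cubic_germ A c f p r" and g: "cubic_germ B d g q s"
    and inv: "lip_inverse_germs \<theta> \<psi>" and fg: "\<forall>\<^sub>F v in nhds 0. f (\<theta> v) = g v"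
  shows "\<exists>\<Theta> \<Psi> L. L-lipschitz_on UNIV \<Theta> \<and> L-lipschitz_on UNIV \<Psi> \<and>
    (\<forall>x. \<Psi> (\<Theta> x) = x) \<and> (\<forall>y. \<Theta> (\<Psi> y) = y) \<and>
    (\<forall>x. (\<forall>l. l \<notin> B \<longrightarrow> x $ l = 0) \<longrightarrow> (\<forall>l. l \<notin> A \<longrightarrow> \<Theta> x $ l = 0) \<and> c (\<Theta> x) = d x) \<and>
    (\<forall>y. (\<forall>l. l \<notin> A \<longrightarrow> y $ l = 0) \<longrightarrow> (\<forall>l. l \<notin> B \<longrightarrow> \<Psi> y $ l = 0) \<and> d (\<Psi> y) = c y)"
proof -
  note inv' = lip_inverse_germs_sym[OF inv]
  have "\<forall>\<^sub>F v in nhds 0. f (\<theta> (\<psi> v)) = g (\<psi> v)"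
    using inv by (intro eventually_compose_filterlim[OF fg] lip_germ_filterlim)
      (simp add: lip_inverse_germs_def)
  moreover have "\<forall>\<^sub>F v in nhds 0. \<theta> (\<psi> v) = v"
    using inv by (simp add: lip_inverse_germs_def)
  ultimately have gf: "\<forall>\<^sub>F v in nhds 0. g (\<psi> v) = f v"
    by eventually_elim simp
  obtain F \<Theta> \<Psi> L where F: "F \<noteq> bot" "F \<le> at_right 0"
    and \<Theta>: "\<And>x. ((\<lambda>e. \<theta> (e *\<^sub>R x) /\<^sub>R e) \<longlongrightarrow> \<Theta> x) F"
    and \<Psi>: "\<And>y. ((\<lambda>e. \<psi> (e *\<^sub>R y) /\<^sub>R e) \<longlongrightarrow> \<Psi> y) F"
    and maps: "\<And>x. \<Psi> (\<Theta> x) = x" "\<And>y. \<Theta> (\<Psi> y) = y"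
      "L-lipschitz_on UNIV \<Theta>" "L-lipschitz_on UNIV \<Psi>"
    using tangent_maps_exist[OF inv] by blast
  have "(\<forall>l. l \<notin> A \<longrightarrow> \<Theta> x $ l = 0) \<and> c (\<Theta> x) = d x" if "\<forall>l. l \<notin> B \<longrightarrow> x $ l = 0" for x
    using tangent_map_cubic[OF f g inv fg gf F \<Theta>, of x] that by blast
  moreover have "(\<forall>l. l \<notin> B \<longrightarrow> \<Psi> y $ l = 0) \<and> d (\<Psi> y) = c y" if "\<forall>l. l \<notin> A \<longrightarrow> y $ l = 0" for y
    using tangent_map_cubic[OF g f inv' gf fg F \<Psi>, of y] that by blast
  ultimately show ?thesis using maps by blast
qed

section \<open>The normal forms of \<open>Q\<^sub>1\<^sub>1\<close> and \<open>S\<^sub>1\<^sub>1\<close>\<close>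

lemma sum_split_three:
  fixes F :: "'n::finite \<Rightarrow> 'a::comm_monoid_add"
  assumes "distinct [i, j, k]"
  shows "sum F UNIV = F i + F j + F k + sum F (- {i, j, k})"
proof -
  have "sum F UNIV = sum F {i, j, k} + sum F (- {i, j, k})"
    using sum.subset_diff[of "{i, j, k}" UNIV F] by (simp add: Compl_eq_Diff_UNIV add.commute)
  then show ?thesis using assms by (simp add: add.assoc)
qed

lemmas vec_nth_has_derivative = bounded_linear.has_derivative[OF bounded_linear_vec_nth]

lemmas complex_scaleR = scaleR_conv_of_real[where 'a = complex]

lemma sum_squares_has_derivative:
  fixes v :: "complex^'n"
  shows "((\<lambda>v. \<Sum>l\<in>A. (v $ l)^2) has_derivative (\<lambda>h. \<Sum>l\<in>A. 2 * v $ l * h $ l)) (at v)"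
  by (rule has_derivative_sum) (auto intro!: derivative_eq_intros vec_nth_has_derivative simp: mult_ac)

text \<open>The terms x z^3 and a z^5 have degrees four and five, so taking out \<open>t^4\<close>
  leaves the powers 0 and 1 of \<open>t\<close> in the remainder.\<close>

lemma Q11_form_cubic_germ:
  assumes dist: "distinct [i, j, k]"
  shows "cubic_germ {i, j, k} (\<lambda>v. (v $ i)^3 + (v $ j)^2 * v $ k) (Q11_form i j k a)
    (\<lambda>v l. if l = i then 3 * (v $ i)^2 + (v $ k)^3 else if l = j then 2 * v $ j * v $ k
      else if l = k then (v $ j)^2 + 3 * v $ i * (v $ k)^2 + 5 * a * (v $ k)^4 else 2 * v $ l)
    (\<lambda>t v. v $ i * (v $ k)^3 + of_real t * a * (v $ k)^5)"
proof (unfold_locales, goal_cases)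
  case (1 v)
  have ne: "j \<noteq> i" "k \<noteq> i" "k \<noteq> j" using dist by auto
  have poly: "((\<lambda>v. (v $ i)^3 + (v $ j)^2 * v $ k + v $ i * (v $ k)^3 + a * (v $ k)^5) has_derivative
    (\<lambda>h. (3 * (v $ i)^2 + (v $ k)^3) * h $ i + 2 * v $ j * v $ k * h $ j
       + ((v $ j)^2 + 3 * v $ i * (v $ k)^2 + 5 * a * (v $ k)^4) * h $ k)) (at v)"
    by (rule has_derivative_eq_rhs, (rule derivative_intros vec_nth_has_derivative)+)
      (simp add: fun_eq_iff algebra_simps power_numeral_reduce)
  have outer: "(\<Sum>l\<in>-{i, j, k}. (if l = i then X else if l = j then Y else if l = k then Z else 2 * v $ l) * h $ l)
      = (\<Sum>l\<in>-{i, j, k}. 2 * v $ l * h $ l)" for h :: "complex^'a" and X Y Z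
    by (rule sum.cong) auto
  show ?case
    unfolding Q11_form_def[abs_def] sum_split_three[OF dist] outer
    using has_derivative_add[OF poly sum_squares_has_derivative[of "- {i, j, k}" v]]
    by (simp add: Compl_eq_Diff_UNIV ne)
next
  case (2 l v)
  then show ?case by simp
next
  case (3 x l)
  have ne: "j \<noteq> i" "k \<noteq> i" "k \<noteq> j" using dist by auto
  \<comment> \<open>In each case the witness is the partial derivative along the ray of
    \<open>x\<close> with the factor \<open>t^2\<close> removed.\<close>
  consider "l = i" | "l = j" | "l = k" | "l \<notin> {i, j, k}" by blast
  then show ?case
  proof cases
    case 1
    then show ?thesis
      by (intro exI[of _ "\<lambda>t. 3 * (x $ i)^2 + of_real t * (x $ k)^3"])
        (intro conjI continuous_intros, simp add: ne complex_scaleR algebra_simps power_numeral_reduce)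
  next
    case 2
    then show ?thesis
      by (intro exI[of _ "\<lambda>t. 2 * x $ j * x $ k"])
        (intro conjI continuous_intros, simp add: ne complex_scaleR algebra_simps power_numeral_reduce)
  next
    case 3
    then show ?thesis
      by (intro exI[of _ "\<lambda>t. (x $ j)^2 + of_real t * 3 * x $ i * (x $ k)^2 + of_real t ^ 2 * 5 * a * (x $ k)^4"])
        (intro conjI continuous_intros, simp add: ne complex_scaleR algebra_simps power_numeral_reduce)
  next
    case 4
    with 3 show ?thesis by (intro exI[of _ "\<lambda>t. 0"]) auto
  qed
next
  case (4 t v)
  show ?case
    unfolding Q11_form_def Compl_eq_Diff_UNIV sum_distrib_left
    by (simp add: complex_scaleR algebra_simps power_numeral_reduce)
qed (simp_all add: case_prod_unfold, (intro continuous_intros)+)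

text \<open>Both x^4 and a x^3 z have degree four, so here the remainder does not depend on
  \<open>t\<close>.\<close>

lemma S11_form_cubic_germ:
  assumes dist: "distinct [i, j, k]"
  shows "cubic_germ {i, j, k} (\<lambda>v. (v $ j)^2 * v $ k + v $ i * (v $ k)^2) (S11_form i j k a)
    (\<lambda>v l. if l = i then 4 * (v $ i)^3 + (v $ k)^2 + 3 * a * (v $ i)^2 * v $ k
      else if l = j then 2 * v $ j * v $ k
      else if l = k then (v $ j)^2 + 2 * v $ i * v $ k + a * (v $ i)^3 else 2 * v $ l)
    (\<lambda>t v. (v $ i)^4 + a * (v $ i)^3 * v $ k)"
proof (unfold_locales, goal_cases)
  case (1 v)
  have ne: "j \<noteq> i" "k \<noteq> i" "k \<noteq> j" using dist by auto
  have poly: "((\<lambda>v. (v $ i)^4 + (v $ j)^2 * v $ k + v $ i * (v $ k)^2 + a * (v $ i)^3 * v $ k) has_derivative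
    (\<lambda>h. (4 * (v $ i)^3 + (v $ k)^2 + 3 * a * (v $ i)^2 * v $ k) * h $ i + 2 * v $ j * v $ k * h $ j
       + ((v $ j)^2 + 2 * v $ i * v $ k + a * (v $ i)^3) * h $ k)) (at v)"
    by (rule has_derivative_eq_rhs, (rule derivative_intros vec_nth_has_derivative)+)
      (simp add: fun_eq_iff algebra_simps power_numeral_reduce)
  have outer: "(\<Sum>l\<in>-{i, j, k}. (if l = i then X else if l = j then Y else if l = k then Z else 2 * v $ l) * h $ l)
      = (\<Sum>l\<in>-{i, j, k}. 2 * v $ l * h $ l)" for h :: "complex^'a" and X Y Z
    by (rule sum.cong) auto
  show ?case
    unfolding S11_form_def[abs_def] sum_split_three[OF dist] outer
    using has_derivative_add[OF poly sum_squares_has_derivative[of "- {i, j, k}" v]]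
    by (simp add: Compl_eq_Diff_UNIV ne)
next
  case (2 l v)
  then show ?case by simp
next
  case (3 x l)
  have ne: "j \<noteq> i" "k \<noteq> i" "k \<noteq> j" using dist by auto
  consider "l = i" | "l = j" | "l = k" | "l \<notin> {i, j, k}" by blast
  then show ?case
  proof cases
    case 1
    then show ?thesis
      by (intro exI[of _ "\<lambda>t. of_real t * 4 * (x $ i)^3 + (x $ k)^2 + of_real t * 3 * a * (x $ i)^2 * x $ k"])
        (intro conjI continuous_intros, simp add: ne complex_scaleR algebra_simps power_numeral_reduce)
  next
    case 2
    then show ?thesis
      by (intro exI[of _ "\<lambda>t. 2 * x $ j * x $ k"])
        (intro conjI continuous_intros, simp add: ne complex_scaleR algebra_simps power_numeral_reduce)
  next
    case 3
    then show ?thesis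
      by (intro exI[of _ "\<lambda>t. (x $ j)^2 + 2 * x $ i * x $ k + of_real t * a * (x $ i)^3"])
        (intro conjI continuous_intros, simp add: ne complex_scaleR algebra_simps power_numeral_reduce)
  next
    case 4
    with 3 show ?thesis by (intro exI[of _ "\<lambda>t. 0"]) auto
  qed
next
  case (4 t v)
  show ?case
    unfolding S11_form_def Compl_eq_Diff_UNIV sum_distrib_left
    by (simp add: complex_scaleR algebra_simps power_numeral_reduce)
qed (simp_all add: case_prod_unfold, (intro continuous_intros)+)

section \<open>The two tangent cubics\<close>

text \<open>The conjugacy is known only on the coordinate subspace of \<open>B\<close>, while
  derivatives need a full neighbourhood. Precomposing with the projection \<pi> onto that subspace
  makes it global, since \<open>d\<close> sees only the coordinates in \<open>B\<close>. The
  comparison of derivatives then applies with constant 0.\<close>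

lemma critical_point_transfer:
  fixes c d :: "complex^'n \<Rightarrow> complex" and \<Theta> :: "complex^'n \<Rightarrow> complex^'n"
  assumes \<Theta>: "L-lipschitz_on UNIV \<Theta>"
    and conj: "\<And>x. (\<And>l. l \<notin> B \<Longrightarrow> x $ l = 0) \<Longrightarrow> c (\<Theta> x) = d x"
    and local: "\<And>x y. (\<And>l. l \<in> B \<Longrightarrow> x $ l = y $ l) \<Longrightarrow> d x = d y"
    and x: "\<And>l. l \<notin> B \<Longrightarrow> x $ l = 0"
    and c: "(c has_derivative (\<lambda>h. 0)) (at (\<Theta> x))" and d: "(d has_derivative D) (at x)"
  shows "D h = 0"
proof -
  define \<pi> :: "complex^'n \<Rightarrow> complex^'n" where "\<pi> v = (\<chi> l. if l \<in> B then v $ l else 0)" for v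
  have "\<pi> x = x" using x by (simp add: \<pi>_def vec_eq_iff)
  have "1-lipschitz_on UNIV \<pi>"
  proof (rule lipschitz_onI)
    fix u v
    have "norm (\<pi> u - \<pi> v) \<le> norm (u - v)"
      by (rule norm_le_componentwise_cart) (simp add: \<pi>_def)
    then show "dist (\<pi> u) (\<pi> v) \<le> 1 * dist u v" by (simp add: dist_norm)
  qed simp
  then have lip: "(L * 1)-lipschitz_on UNIV (\<lambda>v. \<Theta> (\<pi> v))"
    by (rule lipschitz_on_compose2) (rule lipschitz_on_subset[OF \<Theta> subset_UNIV])
  have "c (\<Theta> (\<pi> v)) = d v" for v
    using conj[of "\<pi> v"] local[of "\<pi> v" v] by (simp add: \<pi>_def)
  then have "norm (D h) \<le> 0 * (L * 1) * norm h"
    by (intro has_derivative_norm_le_conjugated[OF _ d _ lip, of c "\<lambda>h. 0"])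
      (auto simp: \<open>\<pi> x = x\<close> c)
  then show ?thesis by simp
qed

text \<open>The cuspidal cone is the image of the map $(s,t) \mapsto (-s^2t, s^3, t^3)$, under which its
  singular line is the image of $s = 0$.\<close>

lemma connected_cuspidal_cone_regular_part:
  assumes dist: "distinct [i, j, k]"
  shows "connected {v :: complex^'n. (\<forall>l. l \<notin> {i, j, k} \<longrightarrow> v $ l = 0) \<and>
    (v $ i)^3 + (v $ j)^2 * v $ k = 0 \<and> \<not> (v $ i = 0 \<and> v $ j = 0)}"  (is "connected ?V")
proof -
  define \<nu> :: "complex \<times> complex \<Rightarrow> complex^'n" where
    "\<nu> = (\<lambda>(s, t). (\<chi> l. if l = i then - (s^2) * t else if l = j then s^3 else if l = k then t^3 else 0))"
  have "?V = \<nu> ` ((- {0}) \<times> UNIV)"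
  proof (intro equalityI subsetI)
    fix v assume v: "v \<in> ?V"
    obtain s where s: "v $ j = s^3" using exists_complex_root[of 3 "v $ j"] by auto
    \<comment> \<open>If the coordinate \<open>j\<close> vanished, the equation of the cone would
      force the coordinate \<open>i\<close> to vanish too, and \<open>v\<close> would lie on the
      singular line.\<close>
    have "s \<noteq> 0"
    proof
      assume "s = 0"
      with s v show False by auto
    qed
    \<comment> \<open>The first coordinate dictates \<open>t\<close>; the equation of the cone then
      yields the third coordinate.\<close>
    define t where "t = - (v $ i) / s^2"
    have "t^3 = - ((v $ i)^3) / (v $ j)^2"
      by (simp add: t_def s power_divide flip: power_mult)
    also have "\<dots> = v $ k"
      using v s \<open>s \<noteq> 0\<close> by (simp add: field_simps add_eq_0_iff)
    finally have "\<nu> (s, t) = v"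
      using v s \<open>s \<noteq> 0\<close> by (auto simp: \<nu>_def vec_eq_iff t_def)
    then show "v \<in> \<nu> ` ((- {0}) \<times> UNIV)" using \<open>s \<noteq> 0\<close> by force
  next
    fix v assume "v \<in> \<nu> ` ((- {0}) \<times> UNIV)"
    then show "v \<in> ?V"
      using dist by (auto simp: \<nu>_def power_mult_distrib simp flip: power_mult)
  qed
  moreover have "connected (\<nu> ` ((- {0}) \<times> UNIV))"
  proof (rule connected_continuous_image)
    have if_fixed: "continuous_on S (\<lambda>p. if b then f p else g p)"
      if "continuous_on S f" "continuous_on S g" for b S and f g :: "complex \<times> complex \<Rightarrow> complex"
      using that by (cases b) auto
    show "continuous_on ((- {0}) \<times> UNIV) \<nu>"
      unfolding \<nu>_def case_prod_unfold by (intro continuous_on_vec_lambda if_fixed continuous_intros)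
    show "connected ((- {0 :: complex}) \<times> (UNIV :: complex set))"
      by (intro connected_Times connected_punctured_universe) auto
  qed
  ultimately show ?thesis by simp
qed

text \<open>The zero sets themselves are cones and thus both connected, so the singular lines have
  to be removed before connectedness can tell them apart. This is why critical points are matched in
  both directions.\<close>

lemma tangent_cubics_not_lipschitz_equivalent:
  fixes \<Theta> \<Psi> :: "complex^'n \<Rightarrow> complex^'n"
  assumes A: "distinct [i, j, k]" and B: "distinct [i', j', k']"
    and lip: "L-lipschitz_on UNIV \<Theta>" "L-lipschitz_on UNIV \<Psi>"
    and inv: "\<And>x. \<Psi> (\<Theta> x) = x" "\<And>y. \<Theta> (\<Psi> y) = y"
    and supp: "\<And>x l. (\<And>l. l \<notin> {i', j', k'} \<Longrightarrow> x $ l = 0) \<Longrightarrow> l \<notin> {i, j, k} \<Longrightarrow> \<Theta> x $ l = 0"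
      "\<And>y l. (\<And>l. l \<notin> {i, j, k} \<Longrightarrow> y $ l = 0) \<Longrightarrow> l \<notin> {i', j', k'} \<Longrightarrow> \<Psi> y $ l = 0"
    and cubic: "\<And>x. (\<And>l. l \<notin> {i', j', k'} \<Longrightarrow> x $ l = 0) \<Longrightarrow>
        (\<Theta> x $ i)^3 + (\<Theta> x $ j)^2 * \<Theta> x $ k = (x $ j')^2 * x $ k' + x $ i' * (x $ k')^2"
      "\<And>y. (\<And>l. l \<notin> {i, j, k} \<Longrightarrow> y $ l = 0) \<Longrightarrow>
        (\<Psi> y $ j')^2 * \<Psi> y $ k' + \<Psi> y $ i' * (\<Psi> y $ k')^2 = (y $ i)^3 + (y $ j)^2 * y $ k"
  shows False
proof -
  define c where "c v = (v $ i)^3 + (v $ j)^2 * v $ k" for v :: "complex^'n"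
  define d where "d v = (v $ j')^2 * v $ k' + v $ i' * (v $ k')^2" for v :: "complex^'n"
  have dc: "(c has_derivative (\<lambda>h. 3 * (v $ i)^2 * h $ i + 2 * v $ j * v $ k * h $ j + (v $ j)^2 * h $ k)) (at v)" for v
    unfolding c_def by (rule has_derivative_eq_rhs, (rule derivative_intros vec_nth_has_derivative)+)
      (simp add: fun_eq_iff algebra_simps power_numeral_reduce)
  have dd: "(d has_derivative (\<lambda>h. (v $ k')^2 * h $ i' + 2 * v $ j' * v $ k' * h $ j'
      + ((v $ j')^2 + 2 * v $ i' * v $ k') * h $ k')) (at v)" for v
    unfolding d_def by (rule has_derivative_eq_rhs, (rule derivative_intros vec_nth_has_derivative)+)
      (simp add: fun_eq_iff algebra_simps power_numeral_reduce)
  \<comment> \<open>Read contrapositively: \<Theta> sends points off the critical line of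
    \<open>d\<close> to points off that of \<open>c\<close>. This is what later places given points
    in the image of \<open>V\<close> under \<Psi>.\<close>
  have sing_d: "x $ j' = 0 \<and> x $ k' = 0"
    if x: "\<And>l. l \<notin> {i', j', k'} \<Longrightarrow> x $ l = 0" and z: "\<Theta> x $ i = 0" "\<Theta> x $ j = 0" for x
  proof -
    have "(c has_derivative (\<lambda>h. 0)) (at (\<Theta> x))" using dc[of "\<Theta> x"] by (simp add: z)
    note crit = critical_point_transfer[OF lip(1) _ _ x this dd, of "{i', j', k'}"]
    have D: "(x $ k')^2 * h $ i' + 2 * x $ j' * x $ k' * h $ j' + ((x $ j')^2 + 2 * x $ i' * x $ k') * h $ k' = 0" for h
      by (rule crit) (use cubic(1) in \<open>auto simp: c_def d_def\<close>)
    \<comment> \<open>The direction \<open>i'\<close> gives z^2 = 0, after which the direction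
      \<open>k'\<close> gives y^2 = 0.\<close>
    from D[of "axis i' 1"] B have "x $ k' = 0" by (auto simp: axis_def)
    with D[of "axis k' 1"] B show ?thesis by (auto simp: axis_def)
  qed
  have sing_c: "y $ i = 0 \<and> y $ j = 0"
    if y: "\<And>l. l \<notin> {i, j, k} \<Longrightarrow> y $ l = 0" and z: "\<Psi> y $ j' = 0" "\<Psi> y $ k' = 0" for y
  proof -
    have "(d has_derivative (\<lambda>h. 0)) (at (\<Psi> y))" using dd[of "\<Psi> y"] by (simp add: z)
    note crit = critical_point_transfer[OF lip(2) _ _ y this dc, of "{i, j, k}"]
    have D: "3 * (y $ i)^2 * h $ i + 2 * y $ j * y $ k * h $ j + (y $ j)^2 * h $ k = 0" for h
      by (rule crit) (use cubic(2) in \<open>auto simp: c_def d_def\<close>)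
    from D[of "axis i 1"] D[of "axis k 1"] A show ?thesis by (auto simp: axis_def)
  qed
  define V where "V = {v :: complex^'n. (\<forall>l. l \<notin> {i, j, k} \<longrightarrow> v $ l = 0) \<and>
    (v $ i)^3 + (v $ j)^2 * v $ k = 0 \<and> \<not> (v $ i = 0 \<and> v $ j = 0)}"
  have "connected (\<Psi> ` V)"
    unfolding V_def
    by (intro connected_continuous_image connected_cuspidal_cone_regular_part[OF A]
        continuous_on_subset[OF lipschitz_on_continuous_on[OF lip(2)]] subset_UNIV)
  \<comment> \<open>These are the zero sets of the two factors in z (y^2 + x z). They meet only
    where y = z = 0, which is the critical line of \<open>d\<close> and is avoided by the image of
    \<open>V\<close>.\<close>
  define P Q where "P = {v :: complex^'n. v $ k' = 0}" and "Q = {v :: complex^'n. (v $ j')^2 + v $ i' * v $ k' = 0}"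
  have closed: "closed P" "closed Q"
    unfolding P_def Q_def by (intro closed_Collect_eq continuous_intros)+
  have cover: "\<Psi> y \<in> P \<union> Q" "\<Psi> y \<notin> P \<inter> Q" if y: "y \<in> V" for y
  proof -
    have "(\<Psi> y $ j')^2 * \<Psi> y $ k' + \<Psi> y $ i' * (\<Psi> y $ k')^2 = 0"
      using cubic(2)[of y] y by (auto simp: V_def)
    then have "\<Psi> y $ k' * ((\<Psi> y $ j')^2 + \<Psi> y $ i' * \<Psi> y $ k') = 0"
      by (simp add: algebra_simps power2_eq_square)
    then show "\<Psi> y \<in> P \<union> Q" by (auto simp: P_def Q_def)
    show "\<Psi> y \<notin> P \<inter> Q"
      using sing_c[of y] y by (auto simp: P_def Q_def V_def)
  qed
  have member: "x \<in> \<Psi> ` V"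
    if x: "\<And>l. l \<notin> {i', j', k'} \<Longrightarrow> x $ l = 0" and "(x $ j')^2 * x $ k' + x $ i' * (x $ k')^2 = 0"
      and "\<not> (x $ j' = 0 \<and> x $ k' = 0)" for x
  proof -
    have "\<Theta> x \<in> V"
      using supp(1)[OF x] cubic(1)[OF x] sing_d[OF x] that by (auto simp: V_def)
    then show ?thesis using inv(1)[of x] by (metis imageI)
  qed
  \<comment> \<open>Both pieces are met: (x, y, z) = (0, 1, 0) lies on z = 0, and (-1, 1, 1) lies on
    y^2 + x z = 0; neither is on the critical line.\<close>
  have "axis j' 1 \<in> P \<inter> \<Psi> ` V"
    using B by (auto intro!: member simp: P_def axis_def)
  moreover have "(\<chi> l. if l = i' then - 1 else if l = j' then 1 else if l = k' then 1 else 0) \<in> Q \<inter> \<Psi> ` V"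
    using B by (auto intro!: member simp: Q_def split: if_splits)
  moreover have "\<Psi> ` V \<subseteq> P \<union> Q" "P \<inter> Q \<inter> \<Psi> ` V = {}"
    using cover by auto
  ultimately have "\<not> connected (\<Psi> ` V)"
    unfolding connected_closed not_not by (intro exI[of _ P] exI[of _ Q] conjI closed) auto
  with \<open>connected (\<Psi> ` V)\<close> show False by contradiction
qed

section \<open>The obstruction applied to germs of \<open>Q11\<close> and \<open>S11\<close>\<close>

theorem lemma8p6:
  assumes "CARD('n::finite) \<ge> 3"
  shows "\<not> (\<exists>f \<in> (Q11 :: (complex^'n \<Rightarrow> complex) set). \<exists>g \<in> S11. bilipschitz_equiv f g)"
proof
  assume "\<exists>f \<in> (Q11 :: (complex^'n \<Rightarrow> complex) set). \<exists>g \<in> S11. bilipschitz_equiv f g"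
  then obtain f g :: "complex^'n \<Rightarrow> complex" and i j k a i' j' k' b
    where fg: "bilipschitz_equiv f g"
    and A: "distinct [i, j, k]" "biholo_equiv f (Q11_form i j k a)"
    and B: "distinct [i', j', k']" "biholo_equiv g (S11_form i' j' k' b)"
    unfolding Q11_def S11_def by blast
  obtain \<theta> \<psi> where inv: "lip_inverse_germs \<theta> \<psi>"
    and eq: "\<forall>\<^sub>F v in nhds 0. Q11_form i j k a (\<theta> v) = S11_form i' j' k' b v"
    using equiv_normal_forms[OF fg A(2) B(2)] by blast
  obtain \<Theta> \<Psi> :: "complex^'n \<Rightarrow> complex^'n" and L
    where maps: "L-lipschitz_on UNIV \<Theta>" "L-lipschitz_on UNIV \<Psi>"
      "\<forall>x. \<Psi> (\<Theta> x) = x" "\<forall>y. \<Theta> (\<Psi> y) = y"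
    and \<Theta>: "\<forall>x. (\<forall>l. l \<notin> {i', j', k'} \<longrightarrow> x $ l = 0) \<longrightarrow> (\<forall>l. l \<notin> {i, j, k} \<longrightarrow> \<Theta> x $ l = 0) \<and>
        (\<Theta> x $ i)^3 + (\<Theta> x $ j)^2 * \<Theta> x $ k = (x $ j')^2 * x $ k' + x $ i' * (x $ k')^2"
    and \<Psi>: "\<forall>y. (\<forall>l. l \<notin> {i, j, k} \<longrightarrow> y $ l = 0) \<longrightarrow> (\<forall>l. l \<notin> {i', j', k'} \<longrightarrow> \<Psi> y $ l = 0) \<and>
        (\<Psi> y $ j')^2 * \<Psi> y $ k' + \<Psi> y $ i' * (\<Psi> y $ k')^2 = (y $ i)^3 + (y $ j)^2 * y $ k"
    using cubic_germs_tangent_homeomorphism[OF Q11_form_cubic_germ[OF A(1)] S11_form_cubic_germ[OF B(1)] inv eq]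
    by (elim exE conjE) (rule that)
  show False
    by (rule tangent_cubics_not_lipschitz_equivalent[OF A(1) B(1) maps(1,2) spec[OF maps(3)] spec[OF maps(4)]])
      (use \<Theta> \<Psi> in blast)+
qed

end
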